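(* Consider the saturation-aware islanded microgrid model with droop control, the standing assumptions and the operating cost $J$ described in the context, over the prediction horizon $k+1,\dots,k+N_p$, and suppose that all conventional units are enabled, i.e. $\delta_{\mathrm t}(k+\tau)=\mathbf 1$ for all $\tau\in\{0,1,\dots,N_p\}$. Define $$\rho_{\mathrm s}^{\min}:=\min_{1\le i\le n_{\mathrm s}}\frac{p_{\mathrm s,i}^{\min}}{\chi_{\mathrm s,i}},\qquad \rho_{\mathrm s}^{\max}:=\max_{1\le i\le n_{\mathrm s}}\frac{p_{\mathrm s,i}^{\max}}{\chi_{\mathrm s,i}},$$ and the constant (time- and disturbance-independent) power setpoints $u^*=[u_{\mathrm t}^{*\mathsf T}\; u_{\mathrm s}^{*\mathsf T}\; u_{\mathrm r}^{*\mathsf T}]^{\mathsf T}$ by $$u_{\mathrm t}^*=p_{\mathrm t}^{\min}-\rho_{\mathrm s}^{\max}\chi_{\mathrm t},\qquad u_{\mathrm r}^*=p_{\mathrm r}^{\max}-\rho_{\mathrm s}^{\min}\chi_{\mathrm r},\qquad u_{\mathrm s}^*=\mathbf 0 .$$ Provided that the setpoint limits $u^{\min}$ are sufficiently low and $u^{\max}$ sufficiently high, possibly even outside of the unit power limits (namely, such that $u^{\min}(k+\tau)\le u^*\le u^{\max}(k+\tau)$ for all $\tau\in\{1,\dots,N_p\}$), the constant setpoints $u^*$ are optimal for every disturbance: for every admissible disturbance trajectory $\mathbf w=[w(k+1)\cdots w(k+N_p)]$, applying $u(k+\tau)=u^*$ for all $\tau\in\{1,\dots,N_p\}$ is feasible,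 and $$J(u^*,\mathbf 1,\mathbf 1,\mathbf w)\;\le\; J(\mathbf u,\mathbf 1,\mathbf 1,\mathbf w)$$ for every setpoint trajectory $\mathbf u=[u(k+1)\cdots u(k+N_p)]$ with $u^{\min}(k+\tau)\le u(k+\tau)\le u^{\max}(k+\tau)$ for all $\tau\in\{1,\dots,N_p\}$, where $J(\mathbf u,\mathbf 1,\mathbf 1,\mathbf w)$ is the cost of the power trajectory resulting from $\mathbf u$ under $\mathbf w$ with all conventional units enabled.
   Context: **Notation.** Inequalities, $\min$, $\max$ between vectors are elementwise; $\mathbf 1,\mathbf 0$ are all-ones and all-zeros vectors. For $z_{\min}\le z_{\max}$, $\operatorname{sat}(z_{\min},z,z_{\max})$ equals $z_{\min}$ if $z<z_{\min}$, $z$ if $z_{\min}\le z\le z_{\max}$, and $z_{\max}$ if $z>z_{\max}$ (elementwise for vectors). **Units and parameters.** There are $n_{\mathrm t}$ conventional (thermal) units, $n_{\mathrm s}$ storage units, $n_{\mathrm r}$ renewable units and $n_{\mathrm d}$ loads (all positive integers). At a time step $j$: $p_{\mathrm t}(j)\in\mathbb R_{\ge0}^{n_{\mathrm t}}$, $p_{\mathrm s}(j)\in\mathbb R^{n_{\mathrm s}}$, $p_{\mathrm r}(j)\in\mathbb R_{\ge0}^{n_{\mathrm r}}$ are power outputs; $u_{\mathrm t}(j),u_{\mathrm s}(j),u_{\mathrm r}(j)$ are the power setpoints, with $u(j)=[u_{\mathrm t}(j)^{\mathsf T}\,u_{\mathrm s}(j)^{\mathsf T}\,u_{\mathrm r}(j)^{\mathsf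 T}]^{\mathsf T}$; $\delta_{\mathrm t}(j)\in\{0,1\}^{n_{\mathrm t}}$ is the on/off status of the conventional units; $x(j)\in\mathbb R_{\ge0}^{n_{\mathrm s}}$ is the stored energy; $\rho(j)\in\mathbb R$ is the frequency deviation (nominal minus actual frequency). The disturbance is $w(j)=[w_{\mathrm r}(j)^{\mathsf T}\,w_{\mathrm d}(j)^{\mathsf T}]^{\mathsf T}$, where $w_{\mathrm r}(j)\in\mathbb R_{\ge 0}^{n_{\mathrm r}}$ is the available renewable power and $w_{\mathrm d}(j)\in\mathbb R_{\le0}^{n_{\mathrm d}}$ is the load. Constant parameters: inverse droop gains $\chi_{\mathrm t},\chi_{\mathrm s},\chi_{\mathrm r}$ (vectors with strictly positive entries); power limits $\mathbf 0\le p_{\mathrm t}^{\min}\le p_{\mathrm t}^{\max}$, $p_{\mathrm s}^{\min}\le\mathbf 0\le p_{\mathrm s}^{\max}$, and $p_{\mathrm r}^{\max}\ge\mathbf 0$; energy limits $x^{\min}\le x^{\max}$; sampling time $T_{\mathrm s}>0$; horizon $N_p\in\mathbb N$. **Model.** For each time step $j\in\{k+1,\dots,k+N_p\}$: - Power balance: $\mathbf 1^{\mathsf T}p_{\mathrm t}(j)+\mathbf 1^{\mathsf T}p_{\mathrm s}(j)+\mathbf 1^{\mathsf T}p_{\mathrm r}(j)+\mathbf 1^{\mathsf T}w_{\mathrm d}(j)=0$. - Conventional units: $p_{\mathrm t}(j)=\operatorname{diag}(\delta_{\mathrm t}(j))\operatorname{sat}(p_{\mathrm t}^{\min},u_{\mathrm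 t}(j)+\chi_{\mathrm t}\rho(j),p_{\mathrm t}^{\max})$. - Storage: $x(j)=x(j-1)-T_{\mathrm s}p_{\mathrm s}(j)$, $x^{\min}\le x(j)\le x^{\max}$, and $p_{\mathrm s}(j)=\operatorname{sat}(\bar p_{\mathrm s}^{\min}(j),u_{\mathrm s}(j)+\chi_{\mathrm s}\rho(j),\bar p_{\mathrm s}^{\max}(j))$ with $\bar p_{\mathrm s}^{\min}(j)=\max(p_{\mathrm s}^{\min},(x(j-1)-x^{\max})/T_{\mathrm s})$ and $\bar p_{\mathrm s}^{\max}(j)=\min(p_{\mathrm s}^{\max},(x(j-1)-x^{\min})/T_{\mathrm s})$. - Renewables: $p_{\mathrm r}(j)=\operatorname{sat}(\mathbf 0,u_{\mathrm r}(j)+\chi_{\mathrm r}\rho(j),w_{\mathrm r}(j))$. The initial stored energy is $x(k)=x^0$ with $x^{\min}\le x^0\le x^{\max}$. Given $\mathbf u$, $\mathbf w$ and the $\delta_{\mathrm t}(j)$, the value $\rho(j)$ is any real number for which these equations hold. A setpoint trajectory is feasible under $\mathbf w$ if such $\rho(j)$, and corresponding powers $p_{\mathrm t}(j),p_{\mathrm s}(j),p_{\mathrm r}(j)$ and energies $x(j)$ satisfying the power balance, the conventional-unit equation, the storage dynamics, storage energy limits and storage saturation equation, the renewable equation, and the initial condition $x(k)=x^0$, exist for all $j\in\{k+1,\dots,k+N_p\}$; under the assumptions below with all conventional units enabled, every setpoint trajectory is feasible, and the resulting powers do not depend on the choice of $\rho(j)$. **Admissible disturbances.** $w(j)$ satisfies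 given bounds $w^{\min}(j)\le w(j)\le w^{\max}(j)$ for every $j\in\{k+1,\dots,k+N_p\}$, with $w_{\mathrm r}(j)\le p_{\mathrm r}^{\max}$, and the load can be fully covered by the conventional units: $\mathbf 1^{\mathsf T}p_{\mathrm t}^{\min}\le-\mathbf 1^{\mathsf T}w_{\mathrm d}(j)\le\mathbf 1^{\mathsf T}p_{\mathrm t}^{\max}$. **Cost.** All conventional units have common cost factors $C_{\mathrm t}\ge0$ (fuel) and $C_{\mathrm{on}}\ge0$ (fixed on-cost), all storage units have a common cost factor $C_{\mathrm s}$, and $C_{\mathrm{sw}}\in\mathbb R_{\ge0}^{n_{\mathrm t}}$ is the switching cost weight. The stage cost is $$\ell(j)=C_{\mathrm t}\mathbf 1^{\mathsf T}p_{\mathrm t}(j)+C_{\mathrm{on}}\mathbf 1^{\mathsf T}\delta_{\mathrm t}(j)+C_{\mathrm{sw}}^{\mathsf T}|\delta_{\mathrm t}(j)-\delta_{\mathrm t}(j-1)|+C_{\mathrm s}\mathbf 1^{\mathsf T}p_{\mathrm s}(j),$$ and $J(\mathbf u,\boldsymbol\delta_{\mathrm t},\delta_{\mathrm t}(k),\mathbf w)=\sum_{\tau=1}^{N_p}\ell(k+\tau)$, evaluated along the powers resulting from $\mathbf u$ under $\mathbf w$ and the statuses $\boldsymbol\delta_{\mathrm t}=[\delta_{\mathrm t}(k+1)\cdots\delta_{\mathrm t}(k+N_p)]$. **Further standing assumptions.** 1. $C_{\mathrm s}\in[0,C_{\mathrm t}]$. 2. Storage units are scaled copies of a prototype: there are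 prototype parameters $\overline\chi_{\mathrm s},\overline p_{\mathrm s}^{\min},\overline p_{\mathrm s}^{\max},\overline x^{\min},\overline x^{\max},\overline x^0\in\mathbb R$ (constants, distinct from the time-varying limits $\bar p_{\mathrm s}^{\min}(j),\bar p_{\mathrm s}^{\max}(j)$) and factors $\sigma_i>0$ such that for each $i\in\{1,\dots,n_{\mathrm s}\}$: $\chi_{\mathrm s,i}=\sigma_i\overline\chi_{\mathrm s}$, $p_{\mathrm s,i}^{\min}=\sigma_i\overline p_{\mathrm s}^{\min}$, $p_{\mathrm s,i}^{\max}=\sigma_i\overline p_{\mathrm s}^{\max}$, $x_i^{\max}-x_i^{\min}=\sigma_i(\overline x^{\max}-\overline x^{\min})$, $x_i^0-x_i^{\min}=\sigma_i(\overline x^0-\overline x^{\min})$. *)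

theory Defs
  imports "HOL-Analysis.Analysis"
begin

text \<open>
  The numbers of conventional, storage and renewable units and of loads are the cardinalities of the
  finite index types \<open>'t\<close>, \<open>'s\<close>, \<open>'r\<close>, \<open>'d\<close>. On \<open>real ^ 'n\<close> the library's \<open>\<le>\<close>, \<open>*\<close> and
  \<open>\<bar>_\<bar>\<close> are componentwise, \<open>1\<close> is the all-ones vector, and \<open>1 \<bullet> v\<close> is the sum of the entries of
  \<open>v\<close>; on pairs \<open>\<le>\<close> is componentwise too. The library's \<open>min\<close> and \<open>max\<close> are not componentwise on
  vectors, so they are applied entry by entry.
\<close>

definition sat :: "real \<Rightarrow> real \<Rightarrow> real \<Rightarrow> real" where
  "sat zmin z zmax = (if z < zmin then zmin else if z \<le> zmax then z else zmax)"

definition vsat :: "real ^ 'n \<Rightarrow> real ^ 'n \<Rightarrow> real ^ 'n \<Rightarrow> real ^ 'n" where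
  "vsat zmin z zmax = (\<chi> i. sat (zmin $ i) (z $ i) (zmax $ i))"

record ('t, 's, 'r) microgrid =
  chi_t :: "(real, 't) vec"
  chi_s :: "(real, 's) vec"
  chi_r :: "(real, 'r) vec"
  p_t_min :: "(real, 't) vec"
  p_t_max :: "(real, 't) vec"
  p_s_min :: "(real, 's) vec"
  p_s_max :: "(real, 's) vec"
  p_r_max :: "(real, 'r) vec"
  x_min :: "(real, 's) vec"
  x_max :: "(real, 's) vec"
  x_init :: "(real, 's) vec"
  T_s :: real
  C_t :: real
  C_on :: real
  C_s :: real
  C_sw :: "(real, 't) vec"

definition valid_parameters :: "('t::finite, 's::finite, 'r::finite) microgrid \<Rightarrow> bool" where
  "valid_parameters G \<longleftrightarrow>
     (\<forall>i. 0 < chi_t G $ i) \<and> (\<forall>i. 0 < chi_s G $ i) \<and> (\<forall>i. 0 < chi_r G $ i) \<and>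
     0 \<le> p_t_min G \<and> p_t_min G \<le> p_t_max G \<and>
     p_s_min G \<le> 0 \<and> 0 \<le> p_s_max G \<and>
     0 \<le> p_r_max G \<and>
     x_min G \<le> x_max G \<and> x_min G \<le> x_init G \<and> x_init G \<le> x_max G \<and>
     0 < T_s G \<and>
     0 \<le> C_t G \<and> 0 \<le> C_on G \<and> 0 \<le> C_sw G"

definition scaled_storage :: "('t::finite, 's::finite, 'r::finite) microgrid \<Rightarrow> bool" where
  "scaled_storage G \<longleftrightarrow>
     (\<exists>(chi' :: real) pmin' pmax' xmin' xmax' x0' (\<sigma> :: 's \<Rightarrow> real). \<forall>i.
        0 < \<sigma> i \<and>
        chi_s G $ i = \<sigma> i * chi' \<and>
        p_s_min G $ i = \<sigma> i * pmin' \<and>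
        p_s_max G $ i = \<sigma> i * pmax' \<and>
        x_max G $ i - x_min G $ i = \<sigma> i * (xmax' - xmin') \<and>
        x_init G $ i - x_min G $ i = \<sigma> i * (x0' - xmin'))"

text \<open>Setpoints \<open>(u\<^sub>t, u\<^sub>s, u\<^sub>r)\<close> and disturbances \<open>(w\<^sub>r, w\<^sub>d)\<close> at one time step.\<close>

type_synonym ('t, 's, 'r) setpoint = "(real, 't) vec \<times> (real, 's) vec \<times> (real, 'r) vec"
type_synonym ('r, 'd) disturbance = "(real, 'r) vec \<times> (real, 'd) vec"

text \<open>
  Only the steps of the horizon \<open>k + 1, \<dots>, k + N\<close> of a trajectory matter, together with step \<open>k\<close>
  for the stored energy and the on/off status.
\<close>

record ('t, 's, 'r) operation =
  rho :: "nat \<Rightarrow> real"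
  p_t :: "nat \<Rightarrow> (real, 't) vec"
  p_s :: "nat \<Rightarrow> (real, 's) vec"
  p_r :: "nat \<Rightarrow> (real, 'r) vec"
  energy :: "nat \<Rightarrow> (real, 's) vec"

definition p_s_lower :: "('t::finite, 's::finite, 'r::finite) microgrid \<Rightarrow> real ^ 's \<Rightarrow> real ^ 's" where
  "p_s_lower G x = (\<chi> i. max (p_s_min G $ i) ((x $ i - x_max G $ i) / T_s G))"

definition p_s_upper :: "('t::finite, 's::finite, 'r::finite) microgrid \<Rightarrow> real ^ 's \<Rightarrow> real ^ 's" where
  "p_s_upper G x = (\<chi> i. min (p_s_max G $ i) ((x $ i - x_min G $ i) / T_s G))"

text \<open>The product \<open>\<delta> * v\<close> of vectors is \<open>diag(\<delta>) v\<close>.\<close>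

definition model_step ::
  "('t::finite, 's::finite, 'r::finite) microgrid \<Rightarrow> real ^ 't \<Rightarrow> ('t, 's, 'r) setpoint \<Rightarrow>
   ('r, 'd::finite) disturbance \<Rightarrow> real ^ 's \<Rightarrow>
   real \<Rightarrow> real ^ 't \<Rightarrow> real ^ 's \<Rightarrow> real ^ 'r \<Rightarrow> real ^ 's \<Rightarrow> bool" where
  "model_step G \<delta> u w x_prev \<rho> pt ps pr x \<longleftrightarrow>
     (case (u, w) of ((ut, us, ur), (wr, wd)) \<Rightarrow>
        1 \<bullet> pt + 1 \<bullet> ps + 1 \<bullet> pr + 1 \<bullet> wd = 0 \<and>
        pt = \<delta> * vsat (p_t_min G) (ut + \<rho> *\<^sub>R chi_t G) (p_t_max G) \<and>
        x = x_prev - T_s G *\<^sub>R ps \<and> x_min G \<le> x \<and> x \<le> x_max G \<and>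
        ps = vsat (p_s_lower G x_prev) (us + \<rho> *\<^sub>R chi_s G) (p_s_upper G x_prev) \<and>
        pr = vsat 0 (ur + \<rho> *\<^sub>R chi_r G) wr)"

definition results_from ::
  "('t::finite, 's::finite, 'r::finite) microgrid \<Rightarrow> nat \<Rightarrow> nat \<Rightarrow> (nat \<Rightarrow> ('t, 's, 'r) setpoint) \<Rightarrow>
   (nat \<Rightarrow> real ^ 't) \<Rightarrow> (nat \<Rightarrow> ('r, 'd::finite) disturbance) \<Rightarrow> ('t, 's, 'r) operation \<Rightarrow> bool" where
  "results_from G k N u \<delta> w y \<longleftrightarrow>
     energy y k = x_init G \<and>
     (\<forall>j\<in>{k+1..k+N}.
        model_step G (\<delta> j) (u j) (w j) (energy y (j - 1))
          (rho y j) (p_t y j) (p_s y j) (p_r y j) (energy y j))"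

definition feasible ::
  "('t::finite, 's::finite, 'r::finite) microgrid \<Rightarrow> nat \<Rightarrow> nat \<Rightarrow> (nat \<Rightarrow> ('t, 's, 'r) setpoint) \<Rightarrow>
   (nat \<Rightarrow> real ^ 't) \<Rightarrow> (nat \<Rightarrow> ('r, 'd::finite) disturbance) \<Rightarrow> bool" where
  "feasible G k N u \<delta> w \<longleftrightarrow> (\<exists>y. results_from G k N u \<delta> w y)"

definition admissible ::
  "('t::finite, 's::finite, 'r::finite) microgrid \<Rightarrow> nat \<Rightarrow> nat \<Rightarrow>
   (nat \<Rightarrow> ('r, 'd::finite) disturbance) \<Rightarrow> (nat \<Rightarrow> ('r, 'd) disturbance) \<Rightarrow>
   (nat \<Rightarrow> ('r, 'd) disturbance) \<Rightarrow> bool" where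
  "admissible G k N w_min w_max w \<longleftrightarrow>
     (\<forall>j\<in>{k+1..k+N}.
        w_min j \<le> w j \<and> w j \<le> w_max j \<and>
        (case w j of (wr, wd) \<Rightarrow>
           0 \<le> wr \<and> wr \<le> p_r_max G \<and> wd \<le> 0 \<and>
           1 \<bullet> p_t_min G \<le> - (1 \<bullet> wd) \<and> - (1 \<bullet> wd) \<le> 1 \<bullet> p_t_max G))"

definition stage_cost ::
  "('t::finite, 's::finite, 'r::finite) microgrid \<Rightarrow> (nat \<Rightarrow> real ^ 't) \<Rightarrow> ('t, 's, 'r) operation \<Rightarrow>
   nat \<Rightarrow> real" where
  "stage_cost G \<delta> y j =
     C_t G * (1 \<bullet> p_t y j) + C_on G * (1 \<bullet> \<delta> j) + C_sw G \<bullet> \<bar>\<delta> j - \<delta> (j - 1)\<bar> + C_s G * (1 \<bullet> p_s y j)"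

text \<open>
  The operating cost \<open>J\<close> of a setpoint trajectory is the \<open>total_cost\<close> of an operation \<open>y\<close>
  with \<open>results_from G k N u \<delta> w y\<close>; \<open>\<delta> k\<close> is the status preceding the horizon.
\<close>

definition total_cost ::
  "('t::finite, 's::finite, 'r::finite) microgrid \<Rightarrow> nat \<Rightarrow> nat \<Rightarrow> (nat \<Rightarrow> real ^ 't) \<Rightarrow>
   ('t, 's, 'r) operation \<Rightarrow> real" where
  "total_cost G k N \<delta> y = (\<Sum>\<tau>=1..N. stage_cost G \<delta> y (k + \<tau>))"

definition rho_s_min :: "('t::finite, 's::finite, 'r::finite) microgrid \<Rightarrow> real" where
  "rho_s_min G = (MIN i. p_s_min G $ i / chi_s G $ i)"

definition rho_s_max :: "('t::finite, 's::finite, 'r::finite) microgrid \<Rightarrow> real" where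
  "rho_s_max G = (MAX i. p_s_max G $ i / chi_s G $ i)"

definition u_star :: "('t::finite, 's::finite, 'r::finite) microgrid \<Rightarrow> ('t, 's, 'r) setpoint" where
  "u_star G =
     (p_t_min G - rho_s_max G *\<^sub>R chi_t G, 0, p_r_max G - rho_s_min G *\<^sub>R chi_r G)"

definition within_limits ::
  "nat \<Rightarrow> nat \<Rightarrow> (nat \<Rightarrow> ('t::finite, 's::finite, 'r::finite) setpoint) \<Rightarrow>
   (nat \<Rightarrow> ('t, 's, 'r) setpoint) \<Rightarrow> (nat \<Rightarrow> ('t, 's, 'r) setpoint) \<Rightarrow> bool" where
  "within_limits k N u_min u_max u \<longleftrightarrow>
     (\<forall>\<tau>\<in>{1..N}. u_min (k + \<tau>) \<le> u (k + \<tau>) \<and> u (k + \<tau>) \<le> u_max (k + \<tau>))"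

end

theory Submission
  imports Defs
begin

text \<open>
  The setpoints \<open>u\<^sup>*\<close> realise a merit order: the conventional units exceed their minimum only when the
  storage discharges at its limit, and renewable infeed is curtailed only when the storage charges
  at its limit. Since the storage units are scaled copies, under \<open>u\<^sup>*\<close> they move in parallel and act
  as one aggregate storage, which the aggregate of any competitor cannot outperform: if \<open>A\<close> is the
  conventional energy that the competitor has used in excess of \<open>u\<^sup>*\<close>, and \<open>D\<close> its surplus of stored
  energy, then \<open>0 \<le> A\<close> and \<open>D \<le> A\<close> hold at all times. The cost difference is
  \<open>C\<^sub>t A - C\<^sub>s D = C\<^sub>s (A - D) + (C\<^sub>t - C\<^sub>s) A\<close> up to the factor \<open>T\<^sub>s\<close>. Feasibility is the intermediate
  value theorem in \<open>\<rho>\<close>.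
\<close>

section \<open>Componentwise saturation and its behaviour in the frequency deviation\<close>

lemma sat_eq_max_min: "a \<le> b \<Longrightarrow> sat a z b = max a (min z b)"
  by (auto simp: sat_def)

lemma vsat_mem: "a \<le> b \<Longrightarrow> a \<le> vsat a z b \<and> vsat a z b \<le> b"
  by (auto simp: vsat_def sat_eq_max_min less_eq_vec_def)

lemma vsat_eq_lower: "a \<le> b \<Longrightarrow> z \<le> a \<Longrightarrow> vsat a z b = a"
  unfolding vec_eq_iff less_eq_vec_def vsat_def
  by (metis sat_eq_max_min max.absorb1 min.coboundedI1 vec_lambda_beta)

lemma vsat_eq_upper: "a \<le> b \<Longrightarrow> b \<le> z \<Longrightarrow> vsat a z b = b"
  unfolding vec_eq_iff less_eq_vec_def vsat_def
  by (simp add: sat_eq_max_min)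

lemma one_inner_eq_sum: "1 \<bullet> (v :: real ^ 'n) = (\<Sum>i\<in>UNIV. v $ i)"
  by (simp add: inner_vec_def)

lemma one_inner_mono: "u \<le> v \<Longrightarrow> 1 \<bullet> (u :: real ^ 'n) \<le> 1 \<bullet> v"
  by (auto simp: one_inner_eq_sum less_eq_vec_def intro: sum_mono)

lemma continuous_on_vsat:
  assumes "a \<le> b"
  shows "continuous_on S (\<lambda>\<rho>. vsat a (u + \<rho> *\<^sub>R \<gamma>) b)"
proof -
  have "vsat a (u + \<rho> *\<^sub>R \<gamma>) b = (\<chi> i. max (a $ i) (min (u $ i + \<rho> * \<gamma> $ i) (b $ i)))" for \<rho>
    using assms by (simp add: vsat_def sat_eq_max_min less_eq_vec_def)
  then show ?thesis
    by (auto intro!: continuous_intros)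
qed

text \<open>Positive gains drive each of the finitely many components to its limit once \<rho> is
  small enough. This and the dual lemma supply the endpoints for the intermediate value
  argument.\<close>

lemma eventually_vsat_eq_lower:
  fixes a b u \<gamma> :: "real ^ 'n"
  assumes "a \<le> b" and "\<And>i. 0 < \<gamma> $ i"
  shows "\<forall>\<^sub>F \<rho> in at_bot. vsat a (u + \<rho> *\<^sub>R \<gamma>) b = a"
proof -
  have "\<forall>\<^sub>F \<rho> in at_bot. \<forall>i. \<rho> \<le> (a $ i - u $ i) / \<gamma> $ i"
    by (intro eventually_all_finite eventually_le_at_bot)
  then show ?thesis
  proof eventually_elim
    case (elim \<rho>)
    then have "u + \<rho> *\<^sub>R \<gamma> \<le> a"
      using assms(2) by (simp add: less_eq_vec_def pos_le_divide_eq le_diff_eq add.commute)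
    with assms(1) show ?case by (rule vsat_eq_lower)
  qed
qed

lemma eventually_vsat_eq_upper:
  fixes a b u \<gamma> :: "real ^ 'n"
  assumes "a \<le> b" and "\<And>i. 0 < \<gamma> $ i"
  shows "\<forall>\<^sub>F \<rho> in at_top. vsat a (u + \<rho> *\<^sub>R \<gamma>) b = b"
proof -
  have "\<forall>\<^sub>F \<rho> in at_top. \<forall>i. (b $ i - u $ i) / \<gamma> $ i \<le> \<rho>"
    by (intro eventually_all_finite eventually_ge_at_top)
  then show ?thesis
  proof eventually_elim
    case (elim \<rho>)
    then have "b \<le> u + \<rho> *\<^sub>R \<gamma>"
      using assms(2) by (simp add: less_eq_vec_def pos_divide_le_eq diff_le_eq add.commute)
    with assms(1) show ?case by (rule vsat_eq_upper)
  qed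
qed

section \<open>Solvability of a single step and feasibility over the horizon\<close>

lemma p_s_lower_nonpos:
  assumes "valid_parameters G" and "x \<le> x_max G"
  shows "p_s_lower G x \<le> 0"
  using assms
  by (auto simp: p_s_lower_def valid_parameters_def less_eq_vec_def divide_le_0_iff)

lemma p_s_upper_nonneg:
  assumes "valid_parameters G" and "x_min G \<le> x"
  shows "0 \<le> p_s_upper G x"
  using assms
  by (auto simp: p_s_upper_def valid_parameters_def less_eq_vec_def)

lemma p_s_lower_le_upper:
  assumes "valid_parameters G" and "x_min G \<le> x" and "x \<le> x_max G"
  shows "p_s_lower G x \<le> p_s_upper G x"
  using p_s_lower_nonpos[of G x] p_s_upper_nonneg[of G x] assms by (auto intro: order_trans)

text \<open>The energy-dependent terms in \<open>p_s_lower\<close> and \<open>p_s_upper\<close> are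
  the energy limits of the next step, solved for the storage power.\<close>

lemma energy_limits_of_storage_power:
  assumes "valid_parameters G" and "p_s_lower G x \<le> ps" and "ps \<le> p_s_upper G x"
  shows "x_min G \<le> x - T_s G *\<^sub>R ps" and "x - T_s G *\<^sub>R ps \<le> x_max G"
proof -
  have T: "0 < T_s G" using assms(1) by (simp add: valid_parameters_def)
  have "(x $ i - x_max G $ i) / T_s G \<le> ps $ i" "ps $ i \<le> (x $ i - x_min G $ i) / T_s G" for i
    using assms(2,3) by (auto simp: p_s_lower_def p_s_upper_def less_eq_vec_def)
  then show "x_min G \<le> x - T_s G *\<^sub>R ps" and "x - T_s G *\<^sub>R ps \<le> x_max G"
    using T by (auto simp: less_eq_vec_def field_simps)
qed

text \<open>The total infeed \<open>f\<close> is continuous in \<rho>. For small \<rho> it is at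
  most the minimal conventional power, as storage charges or idles and renewables give 0; for large
  \<rho> it is at least the maximal conventional power. The load lies in between.\<close>

lemma ex_model_step:
  fixes G :: "('t::finite, 's::finite, 'r::finite) microgrid"
    and wr :: "real ^ 'r" and wd :: "real ^ 'd::finite"
  assumes G: "valid_parameters G" and x: "x_min G \<le> x" "x \<le> x_max G"
    and wr: "0 \<le> wr"
    and load: "1 \<bullet> p_t_min G \<le> - (1 \<bullet> wd)" "- (1 \<bullet> wd) \<le> 1 \<bullet> p_t_max G"
  shows "\<exists>\<rho> pt ps pr x'. model_step G 1 u (wr, wd) x \<rho> pt ps pr x'"
proof -
  obtain ut us ur where u: "u = (ut, us, ur)" by (cases u)
  define pt where "pt \<rho> = vsat (p_t_min G) (ut + \<rho> *\<^sub>R chi_t G) (p_t_max G)" for \<rho>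
  define ps where "ps \<rho> = vsat (p_s_lower G x) (us + \<rho> *\<^sub>R chi_s G) (p_s_upper G x)" for \<rho>
  define pr where "pr \<rho> = vsat 0 (ur + \<rho> *\<^sub>R chi_r G) wr" for \<rho>
  define f where "f \<rho> = 1 \<bullet> pt \<rho> + 1 \<bullet> ps \<rho> + 1 \<bullet> pr \<rho>" for \<rho>
  have chi: "\<And>i. 0 < chi_t G $ i" "\<And>i. 0 < chi_s G $ i" "\<And>i. 0 < chi_r G $ i"
    and pt_le: "p_t_min G \<le> p_t_max G"
    using G by (auto simp: valid_parameters_def)
  note ps_le = p_s_lower_le_upper[OF G x]
  have cont: "continuous_on S f" for S
    unfolding f_def pt_def ps_def pr_def
    by (intro continuous_intros continuous_on_vsat pt_le ps_le wr)
  have "\<forall>\<^sub>F \<rho> in at_bot. pt \<rho> = p_t_min G \<and> ps \<rho> = p_s_lower G x \<and> pr \<rho> = 0"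
    unfolding pt_def ps_def pr_def
    by (intro eventually_conj eventually_vsat_eq_lower pt_le ps_le wr chi)
  \<comment> \<open>Fixing the sign of \<open>lo\<close>, and of \<open>hi\<close> below, ensures
    \<open>lo \<le> hi\<close>, as the intermediate value theorem requires.\<close>
  moreover have "\<forall>\<^sub>F \<rho> in at_bot. \<rho> \<le> (0::real)"
    by (rule eventually_le_at_bot)
  ultimately obtain lo where lo:
      "pt lo = p_t_min G" "ps lo = p_s_lower G x" "pr lo = 0" "lo \<le> 0"
    using eventually_happens'[OF trivial_limit_at_bot_linorder eventually_conj] by blast
  have "\<forall>\<^sub>F \<rho> in at_top. pt \<rho> = p_t_max G \<and> ps \<rho> = p_s_upper G x \<and> pr \<rho> = wr"
    unfolding pt_def ps_def pr_def
    by (intro eventually_conj eventually_vsat_eq_upper pt_le ps_le wr chi)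
  moreover have "\<forall>\<^sub>F \<rho> in at_top. (0::real) \<le> \<rho>"
    by (rule eventually_ge_at_top)
  ultimately obtain hi where hi:
      "pt hi = p_t_max G" "ps hi = p_s_upper G x" "pr hi = wr" "0 \<le> hi"
    using eventually_happens'[OF trivial_limit_at_top_linorder eventually_conj] by blast
  have "f lo \<le> - (1 \<bullet> wd)"
    using load(1) one_inner_mono[OF p_s_lower_nonpos[OF G x(2)]] by (simp add: f_def lo)
  moreover have "- (1 \<bullet> wd) \<le> f hi"
    using load(2) one_inner_mono[OF p_s_upper_nonneg[OF G x(1)]] one_inner_mono[OF wr]
    by (simp add: f_def hi)
  moreover have "lo \<le> hi" using lo hi by simp
  ultimately obtain \<rho> where \<rho>: "f \<rho> = - (1 \<bullet> wd)"
    using IVT'[of f lo _ hi] cont by blast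
  have "p_s_lower G x \<le> ps \<rho>" "ps \<rho> \<le> p_s_upper G x"
    using vsat_mem[OF ps_le] by (auto simp: ps_def)
  note energy_limits_of_storage_power[OF G this]
  then have "model_step G 1 u (wr, wd) x \<rho> (pt \<rho>) (ps \<rho>) (pr \<rho>) (x - T_s G *\<^sub>R ps \<rho>)"
    using \<rho> by (simp add: model_step_def u f_def pt_def ps_def pr_def)
  then show ?thesis by blast
qed

lemma results_from_energy_limits:
  assumes "valid_parameters G" and "results_from G k N u \<delta> w y" and "n \<le> N"
  shows "x_min G \<le> energy y (k + n)" and "energy y (k + n) \<le> x_max G"
proof -
  have "x_min G \<le> energy y (k + n) \<and> energy y (k + n) \<le> x_max G"
  proof (cases n)
    case 0
    with assms(1,2) show ?thesis by (simp add: results_from_def valid_parameters_def)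
  next
    case (Suc m)
    with assms(3) have "k + n \<in> {k+1..k+N}" by simp
    with assms(2) have "model_step G (\<delta> (k + n)) (u (k + n)) (w (k + n)) (energy y (k + n - 1))
        (rho y (k + n)) (p_t y (k + n)) (p_s y (k + n)) (p_r y (k + n)) (energy y (k + n))"
      unfolding results_from_def by blast
    then show ?thesis
      unfolding model_step_def by (auto split: prod.splits)
  qed
  then show "x_min G \<le> energy y (k + n)" and "energy y (k + n) \<le> x_max G" by auto
qed

text \<open>An operation is extended one step at a time: each step ends within the energy limits,
  which is what solving the next one requires of the stored energy.\<close>

lemma feasible_all_enabled:
  fixes G :: "('t::finite, 's::finite, 'r::finite) microgrid"
    and w :: "nat \<Rightarrow> ('r, 'd::finite) disturbance"
  assumes G: "valid_parameters G" and w: "admissible G k N w_min w_max w"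
    and \<delta>: "\<And>j. j \<in> {k+1..k+N} \<Longrightarrow> \<delta> j = 1"
  shows "feasible G k N u \<delta> w"
proof -
  have "\<exists>y. results_from G k n u \<delta> w y" if "n \<le> N" for n
    using that
  proof (induction n)
    case 0
    have "results_from G k 0 u \<delta> w
        \<lparr>rho = \<lambda>_. 0, p_t = \<lambda>_. 0, p_s = \<lambda>_. 0, p_r = \<lambda>_. 0, energy = \<lambda>_. x_init G\<rparr>"
      by (simp add: results_from_def)
    then show ?case by blast
  next
    case (Suc n)
    then obtain y where y: "results_from G k n u \<delta> w y" by auto
    define j where "j = k + Suc n"
    have j: "j \<in> {k+1..k+N}" using Suc.prems by (auto simp: j_def)
    obtain wr wd where wj: "w j = (wr, wd)" by (cases "w j")
    have "0 \<le> wr" "1 \<bullet> p_t_min G \<le> - (1 \<bullet> wd)" "- (1 \<bullet> wd) \<le> 1 \<bullet> p_t_max G"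
      using w j wj by (auto simp: admissible_def dest!: bspec)
    from ex_model_step[OF G results_from_energy_limits[OF G y order_refl] this]
    obtain \<rho> pt ps pr x where step: "model_step G 1 (u j) (w j) (energy y (k + n)) \<rho> pt ps pr x"
      unfolding wj by blast
    define y' where "y' = \<lparr>rho = (rho y)(j := \<rho>), p_t = (p_t y)(j := pt), p_s = (p_s y)(j := ps),
      p_r = (p_r y)(j := pr), energy = (energy y)(j := x)\<rparr>"
    have "model_step G (\<delta> i) (u i) (w i) (energy y' (i - 1))
            (rho y' i) (p_t y' i) (p_s y' i) (p_r y' i) (energy y' i)"
      if i: "i \<in> {k+1..k + Suc n}" for i
    proof (cases "i = j")
      case True
      then show ?thesis using step \<delta>[OF j] by (simp add: y'_def j_def)
    next
      case False
      \<comment> \<open>Earlier steps also read the energy at \<open>i - 1\<close>, so the update at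
        \<open>j\<close> must not touch that index either.\<close>
      then have "i \<in> {k+1..k+n}" "i - 1 \<noteq> j" using i by (auto simp: j_def)
      with False y show ?thesis by (auto simp: y'_def results_from_def)
    qed
    moreover have "energy y' k = x_init G"
      using y by (simp add: y'_def j_def results_from_def)
    ultimately show ?case unfolding results_from_def by blast
  qed
  then show ?thesis by (auto simp: feasible_def)
qed

section \<open>The merit order under \<open>u_star\<close>\<close>

text \<open>The gain vector \<open>chi_s G\<close> is itself proportional to the scaling factors and
  can replace them. The quotients in \<open>rho_s_min\<close> and \<open>rho_s_max\<close> then
  agree for all units.\<close>

lemma scaled_storage_chi_s:
  fixes G :: "('t::finite, 's::finite, 'r::finite) microgrid"
  assumes G: "valid_parameters G" and S: "scaled_storage G"
  obtains e\<^sub>0 e\<^sub>1 where "p_s_min G = rho_s_min G *\<^sub>R chi_s G" and "p_s_max G = rho_s_max G *\<^sub>R chi_s G"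
    and "x_max G = x_min G + e\<^sub>1 *\<^sub>R chi_s G" and "x_init G = x_min G + e\<^sub>0 *\<^sub>R chi_s G"
proof -
  obtain c pmin pmax xmin xmax x0 :: real and \<sigma> :: "'s \<Rightarrow> real" where *:
    "\<And>i. 0 < \<sigma> i" "\<And>i. chi_s G $ i = \<sigma> i * c"
    "\<And>i. p_s_min G $ i = \<sigma> i * pmin" "\<And>i. p_s_max G $ i = \<sigma> i * pmax"
    "\<And>i. x_max G $ i - x_min G $ i = \<sigma> i * (xmax - xmin)"
    "\<And>i. x_init G $ i - x_min G $ i = \<sigma> i * (x0 - xmin)"
    using S unfolding scaled_storage_def by metis
  have chi: "0 < chi_s G $ i" for i using G by (simp add: valid_parameters_def)
  have c: "0 < c" using chi * by (metis zero_less_mult_pos)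
  have "p_s_min G $ i / chi_s G $ i = pmin / c" "p_s_max G $ i / chi_s G $ i = pmax / c" for i
    using *(1)[of i] by (simp_all add: *(2-4))
  then have rho: "rho_s_min G = pmin / c" "rho_s_max G = pmax / c"
    by (simp_all add: rho_s_min_def rho_s_max_def)
  show ?thesis
  proof (rule that)
    show "p_s_min G = rho_s_min G *\<^sub>R chi_s G" "p_s_max G = rho_s_max G *\<^sub>R chi_s G"
      using c by (simp_all add: vec_eq_iff rho *(2-4))
    show "x_max G = x_min G + ((xmax - xmin) / c) *\<^sub>R chi_s G"
      "x_init G = x_min G + ((x0 - xmin) / c) *\<^sub>R chi_s G"
      using c by (simp_all add: vec_eq_iff *(2) mult.commute flip: *(5,6))
  qed
qed

lemma sat_mult_right: "0 < c \<Longrightarrow> sat (a * c) (z * c) (b * c) = sat a z b * c"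
  by (simp add: sat_def)

text \<open>With storage setpoint 0, the storage power limits are reached at
  \<open>\<rho> = rho_s_min G\<close> and \<open>\<rho> = rho_s_max G\<close>, unless an energy
  limit binds earlier. The offsets in \<open>u_star\<close> let conventional units leave their
  minimum only above the upper threshold and renewables be curtailed only below the lower one. The
  last claim keeps the units parallel for the next step.\<close>

lemma u_star_step_merit_order:
  fixes G :: "('t::finite, 's::finite, 'r::finite) microgrid"
    and wr :: "real ^ 'r" and wd :: "real ^ 'd::finite"
  assumes G: "valid_parameters G" and S: "scaled_storage G"
    and wr: "0 \<le> wr" "wr \<le> p_r_max G"
    and xp: "xp = x_min G + e *\<^sub>R chi_s G" "x_min G \<le> xp" "xp \<le> x_max G"
    and step: "model_step G 1 (u_star G) (wr, wd) xp \<rho> pt ps pr x"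
  shows "pt = p_t_min G \<or> pr = wr \<and> (ps = p_s_max G \<or> x = x_min G)"
    and "pr = wr \<or> pt = p_t_min G \<and> (ps = p_s_min G \<or> x = x_max G)"
    and "\<exists>e'. x = x_min G + e' *\<^sub>R chi_s G"
proof -
  define T where "T = T_s G"
  define a where "a = rho_s_min G"
  define b where "b = rho_s_max G"
  obtain e\<^sub>1 where par: "p_s_min G = a *\<^sub>R chi_s G" "p_s_max G = b *\<^sub>R chi_s G"
      "x_max G = x_min G + e\<^sub>1 *\<^sub>R chi_s G"
    using scaled_storage_chi_s[OF G S] unfolding a_def b_def by metis
  have chi: "\<And>i. 0 < chi_t G $ i" "\<And>i. 0 < chi_s G $ i" "\<And>i. 0 < chi_r G $ i"
    and T: "0 < T" and pt_le: "p_t_min G \<le> p_t_max G"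
    using G by (auto simp: valid_parameters_def T_def)
  \<comment> \<open>Any one component determines the signs, as all storage vectors are multiples of
    the positive vector \<open>chi_s G\<close>; \<open>undefined\<close> serves as an arbitrary
    index.\<close>
  have "p_s_min G $ undefined \<le> 0" "0 \<le> p_s_max G $ undefined"
    using G by (auto simp: valid_parameters_def less_eq_vec_def)
  then have "a \<le> 0" "0 \<le> b"
    using chi(2)[of undefined] by (auto simp: par mult_le_0_iff zero_le_mult_iff)
  have "x_min G $ undefined \<le> xp $ undefined" "xp $ undefined \<le> x_max G $ undefined"
    using xp by (auto simp: less_eq_vec_def)
  then have "0 \<le> e" "e \<le> e\<^sub>1"
    using chi(2)[of undefined] by (auto simp: par xp(1) zero_le_mult_iff)
  \<comment> \<open>\<open>q\<close> is the storage power per unit of gain, common to all storage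
    units.\<close>
  define q where "q = sat (max a ((e - e\<^sub>1) / T)) \<rho> (min b (e / T))"
  have lower: "p_s_lower G xp = max a ((e - e\<^sub>1) / T) *\<^sub>R chi_s G"
    using less_imp_le[OF chi(2)] by (simp add: p_s_lower_def vec_eq_iff par xp(1) T_def[symmetric]
        max_mult_distrib_right flip: left_diff_distrib)
  have upper: "p_s_upper G xp = min b (e / T) *\<^sub>R chi_s G"
    using less_imp_le[OF chi(2)] by (simp add: p_s_upper_def vec_eq_iff par xp(1) T_def[symmetric]
        min_mult_distrib_right)
  have pt: "pt = vsat (p_t_min G) (p_t_min G + (\<rho> - b) *\<^sub>R chi_t G) (p_t_max G)"
    and pr: "pr = vsat 0 (p_r_max G + (\<rho> - a) *\<^sub>R chi_r G) wr"
    and x: "x = xp - T *\<^sub>R ps"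
    and ps': "ps = vsat (p_s_lower G xp) (\<rho> *\<^sub>R chi_s G) (p_s_upper G xp)"
    using step by (auto simp: model_step_def u_star_def a_def b_def T_def algebra_simps)
  have ps: "ps = q *\<^sub>R chi_s G"
    unfolding ps' lower upper q_def vsat_def vec_eq_iff
    by (simp add: sat_mult_right chi(2))
  have x': "x = x_min G + (e - T * q) *\<^sub>R chi_s G"
    by (simp add: x ps xp(1) algebra_simps)
  then show "\<exists>e'. x = x_min G + e' *\<^sub>R chi_s G" by blast
  have pt_min: "pt = p_t_min G" if "\<rho> \<le> b"
    unfolding pt using pt_le chi(1) that
    by (intro vsat_eq_lower) (auto simp: less_eq_vec_def mult_le_0_iff less_imp_le)
  have pr_max: "pr = wr" if "a \<le> \<rho>"
  proof -
    have "wr \<le> p_r_max G + (\<rho> - a) *\<^sub>R chi_r G"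
      using wr(2) less_imp_le[OF chi(3)] that by (simp add: less_eq_vec_def add_increasing2)
    with wr(1) show ?thesis unfolding pr by (rule vsat_eq_upper)
  qed
  have bounds: "max a ((e - e\<^sub>1) / T) \<le> 0" "0 \<le> min b (e / T)"
    using \<open>a \<le> 0\<close> \<open>0 \<le> b\<close> \<open>0 \<le> e\<close> \<open>e \<le> e\<^sub>1\<close> T by (auto simp: divide_le_0_iff)
  have "q = min b (e / T)" if "b < \<rho>"
    using bounds that by (auto simp: q_def sat_def)
  \<comment> \<open>If \<open>b\<close> attains the minimum, the power limit binds; otherwise
    \<open>e - T * q = 0\<close> and the step empties all storage units at once.\<close>
  then have discharge: "ps = p_s_max G \<or> x = x_min G" if "b < \<rho>"
    using that T by (auto simp: ps par x' min_def split: if_splits)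
  have "q = max a ((e - e\<^sub>1) / T)" if "\<rho> < a"
    using bounds that by (auto simp: q_def sat_def)
  then have charge: "ps = p_s_min G \<or> x = x_max G" if "\<rho> < a"
    using that T by (auto simp: ps par x' max_def split: if_splits)
  show "pt = p_t_min G \<or> pr = wr \<and> (ps = p_s_max G \<or> x = x_min G)"
    using pt_min pr_max discharge \<open>a \<le> 0\<close> \<open>0 \<le> b\<close> by (cases "\<rho> \<le> b") auto
  show "pr = wr \<or> pt = p_t_min G \<and> (ps = p_s_min G \<or> x = x_max G)"
    using pt_min pr_max charge \<open>a \<le> 0\<close> \<open>0 \<le> b\<close> by (cases "a \<le> \<rho>") auto
qed

section \<open>Comparison of \<open>u_star\<close> with a competitor\<close>

lemma model_step_limits:
  assumes G: "valid_parameters G" and x: "x_min G \<le> xp" "xp \<le> x_max G" and "0 \<le> wr"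
    and step: "model_step G 1 u (wr, wd) xp \<rho> pt ps pr x"
  shows "p_t_min G \<le> pt" and "p_s_min G \<le> ps" and "ps \<le> p_s_max G" and "pr \<le> wr"
    and "x_min G \<le> x" and "x \<le> x_max G"
proof -
  have "p_t_min G \<le> p_t_max G" using G by (simp add: valid_parameters_def)
  with step \<open>0 \<le> wr\<close> show "p_t_min G \<le> pt" "pr \<le> wr" "x_min G \<le> x" "x \<le> x_max G"
    by (auto simp: model_step_def vsat_mem split: prod.splits)
  have "p_s_lower G xp \<le> ps" "ps \<le> p_s_upper G xp"
    using step vsat_mem[OF p_s_lower_le_upper[OF G x]]
    by (auto simp: model_step_def split: prod.splits)
  then show "p_s_min G \<le> ps" "ps \<le> p_s_max G"
    by (auto simp: p_s_lower_def p_s_upper_def less_eq_vec_def)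
qed

text \<open>
  \<open>A\<close> and \<open>D\<close> are the competitor's accumulated surplus of conventional power and its surplus of stored
  energy; \<open>a\<close>, \<open>s\<close> and \<open>- c\<close> are its surpluses of conventional, storage and renewable power
  in the current step.
\<close>

lemma merit_order_invariant_step:
  fixes A D T a s c :: real
  assumes T: "0 < T" and inv: "0 \<le> A" "D \<le> T * A" and bal: "a + s = c"
    and conventional: "0 \<le> a \<or> 0 \<le> c \<and> (s \<le> 0 \<or> 0 \<le> D - T * s)"
    and renewable: "0 \<le> c \<or> 0 \<le> a \<and> (0 \<le> s \<or> D - T * s \<le> 0)"
  shows "0 \<le> A + a" and "D - T * s \<le> T * (A + a)"
proof -
  have D_le: "D - T * s \<le> T * (A + a)" if "0 \<le> c"
  proof -
    have "0 \<le> T * (a + s)" using T that bal by simp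
    with inv show ?thesis by (simp add: algebra_simps)
  qed
  show A: "0 \<le> A + a"
  proof (cases "0 \<le> a \<or> s \<le> 0")
    case True
    with inv bal conventional show ?thesis by auto
  next
    case False
    \<comment> \<open>Here \<open>a < 0 < s\<close>, so \<open>conventional\<close> leaves only
      \<open>0 \<le> c\<close> and \<open>0 \<le> D - T * s\<close>; the bound \<open>D_le\<close>
      then lies above a nonnegative quantity.\<close>
    with conventional D_le have "0 \<le> T * (A + a)" by auto
    with T show ?thesis by (simp add: zero_le_mult_iff)
  qed
  show "D - T * s \<le> T * (A + a)"
  proof (cases "0 \<le> c")
    case True
    then show ?thesis by (rule D_le)
  next
    case False
    then consider "0 \<le> a" "0 \<le> s" | "D - T * s \<le> 0" using renewable by auto
    then show ?thesis
    proof cases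
      case 1
      then have "0 \<le> T * a" "0 \<le> T * s" using T by auto
      with inv show ?thesis by (simp add: algebra_simps)
    next
      case 2
      moreover have "0 \<le> T * (A + a)" using A T by simp
      ultimately show ?thesis by linarith
    qed
  qed
qed

text \<open>Induction over the steps. Parallel storage makes the merit order applicable, the energy
  identity links \<open>D\<close> to storage power, and the last two conjuncts are the
  invariant.\<close>

lemma u_star_merit_order:
  fixes G :: "('t::finite, 's::finite, 'r::finite) microgrid"
    and w :: "nat \<Rightarrow> ('r, 'd::finite) disturbance"
  assumes G: "valid_parameters G" and S: "scaled_storage G"
    and w: "admissible G k N w_min w_max w"
    and \<delta>: "\<And>j. j \<in> {k+1..k+N} \<Longrightarrow> \<delta> j = 1"
    and y': "results_from G k N (\<lambda>_. u_star G) \<delta> w y'" and y: "results_from G k N u \<delta> w y"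
    and "n \<le> N"
  shows "(\<exists>e. energy y' (k + n) = x_min G + e *\<^sub>R chi_s G) \<and>
    1 \<bullet> (energy y (k + n) - energy y' (k + n)) =
      - T_s G * (\<Sum>\<tau>=1..n. 1 \<bullet> (p_s y (k + \<tau>) - p_s y' (k + \<tau>))) \<and>
    0 \<le> (\<Sum>\<tau>=1..n. 1 \<bullet> (p_t y (k + \<tau>) - p_t y' (k + \<tau>))) \<and>
    1 \<bullet> (energy y (k + n) - energy y' (k + n)) \<le>
      T_s G * (\<Sum>\<tau>=1..n. 1 \<bullet> (p_t y (k + \<tau>) - p_t y' (k + \<tau>)))"
  using \<open>n \<le> N\<close>
proof (induction n)
  case 0
  have "\<exists>e. x_init G = x_min G + e *\<^sub>R chi_s G"
    using scaled_storage_chi_s[OF G S] by metis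
  with y y' show ?case by (simp add: results_from_def)
next
  case (Suc n)
  define j where "j = k + Suc n"
  define A where "A = (\<Sum>\<tau>=1..n. 1 \<bullet> (p_t y (k + \<tau>) - p_t y' (k + \<tau>)))"
  define D where "D = 1 \<bullet> (energy y (k + n) - energy y' (k + n))"
  define a where "a = 1 \<bullet> (p_t y j - p_t y' j)"
  define s where "s = 1 \<bullet> (p_s y j - p_s y' j)"
  have T: "0 < T_s G" using G by (simp add: valid_parameters_def)
  have j: "j \<in> {k+1..k+N}" using Suc.prems by (auto simp: j_def)
  obtain wr wd where wj: "w j = (wr, wd)" by (cases "w j")
  have wr: "0 \<le> wr" "wr \<le> p_r_max G"
    using w j wj by (auto simp: admissible_def dest!: bspec)
  have n: "n \<le> N" using Suc.prems by simp
  note x = results_from_energy_limits[OF G y n] and x' = results_from_energy_limits[OF G y' n]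
  have "j - 1 = k + n" by (simp add: j_def)
  with y y' j \<delta>[OF j] wj have
    step: "model_step G 1 (u j) (wr, wd) (energy y (k + n))
      (rho y j) (p_t y j) (p_s y j) (p_r y j) (energy y j)" and
    step': "model_step G 1 (u_star G) (wr, wd) (energy y' (k + n))
      (rho y' j) (p_t y' j) (p_s y' j) (p_r y' j) (energy y' j)"
    unfolding results_from_def by metis+
  obtain e where e: "energy y' (k + n) = x_min G + e *\<^sub>R chi_s G"
    and IH: "D = - T_s G * (\<Sum>\<tau>=1..n. 1 \<bullet> (p_s y (k + \<tau>) - p_s y' (k + \<tau>)))" "0 \<le> A" "D \<le> T_s G * A"
    using Suc.IH[OF n] unfolding A_def D_def by blast
  note lim = model_step_limits[OF G x wr(1) step]
  note lim' = model_step_limits[OF G x' wr(1) step']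
  note merit = u_star_step_merit_order[OF G S wr e x' step']
  define c where "c = 1 \<bullet> (p_r y' j - p_r y j)"
  \<comment> \<open>Both operations serve the same load, so it cancels between the two power
    balances.\<close>
  have bal: "a + s = c"
    using step step' by (simp add: model_step_def a_def s_def c_def inner_diff_right split: prod.splits)
  have "energy y j = energy y (k + n) - T_s G *\<^sub>R p_s y j"
    "energy y' j = energy y' (k + n) - T_s G *\<^sub>R p_s y' j"
    using step step' unfolding model_step_def by (auto split: prod.splits)
  then have D': "1 \<bullet> (energy y j - energy y' j) = D - T_s G * s"
    by (simp add: D_def s_def inner_diff_right right_diff_distrib)
  have mono: "0 \<le> 1 \<bullet> (v - v')" if "v' \<le> v" for v v' :: "real ^ 'n"
    using one_inner_mono[OF that] by (simp add: inner_diff_right)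
  have mono': "1 \<bullet> (v - v') \<le> 0" if "v \<le> v'" for v v' :: "real ^ 'n"
    using one_inner_mono[OF that] by (simp add: inner_diff_right)
  \<comment> \<open>Each extreme attained by \<open>y'\<close> fixes a sign, since the competitor
    obeys the same limit: minimal \<open>p_t\<close> gives \<open>0 \<le> a\<close>, full renewable
    infeed \<open>0 \<le> c\<close>, maximal discharge \<open>s \<le> 0\<close>, and empty storage a
    nonnegative energy surplus.\<close>
  have "0 \<le> a \<or> 0 \<le> c \<and> (s \<le> 0 \<or> 0 \<le> D - T_s G * s)"
    unfolding D'[symmetric] using merit(1) lim
    by (auto simp: a_def c_def s_def intro!: mono mono')
  moreover have "0 \<le> c \<or> 0 \<le> a \<and> (0 \<le> s \<or> D - T_s G * s \<le> 0)"
    unfolding D'[symmetric] using merit(2) lim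
    by (auto simp: a_def c_def s_def intro!: mono mono')
  ultimately have "0 \<le> A + a" "D - T_s G * s \<le> T_s G * (A + a)"
    using merit_order_invariant_step[OF T IH(2,3) bal] by blast+
  with merit(3) D' IH(1) show ?case
    by (simp add: A_def a_def s_def j_def algebra_simps)
qed

theorem proposition1:
  fixes G :: "('t::finite, 's::finite, 'r::finite) microgrid"
    and k N :: nat
    and \<delta> :: "nat \<Rightarrow> real ^ 't"
    and u_min u_max :: "nat \<Rightarrow> ('t, 's, 'r) setpoint"
    and w_min w_max :: "nat \<Rightarrow> ('r, 'd::finite) disturbance"
  assumes "valid_parameters G"
    and "0 \<le> C_s G" and "C_s G \<le> C_t G"
    and "scaled_storage G"
    and "\<forall>\<tau>\<in>{0..N}. \<delta> (k + \<tau>) = 1"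
    and "within_limits k N u_min u_max (\<lambda>_. u_star G)"
  shows "\<forall>w. admissible G k N w_min w_max w \<longrightarrow>
           feasible G k N (\<lambda>_. u_star G) \<delta> w \<and>
           (\<forall>u y_star y. within_limits k N u_min u_max u \<longrightarrow>
              results_from G k N (\<lambda>_. u_star G) \<delta> w y_star \<longrightarrow>
              results_from G k N u \<delta> w y \<longrightarrow>
              total_cost G k N \<delta> y_star \<le> total_cost G k N \<delta> y)"
proof (intro allI impI conjI)
  fix w :: "nat \<Rightarrow> ('r, 'd) disturbance"
  assume w: "admissible G k N w_min w_max w"
  have \<delta>: "\<delta> j = 1" if "j \<in> {k+1..k+N}" for j
    using assms(5)[rule_format, of "j - k"] that by auto
  show "feasible G k N (\<lambda>_. u_star G) \<delta> w"
    using assms(1) w \<delta> by (rule feasible_all_enabled)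
  fix u y_star y
  assume y_star: "results_from G k N (\<lambda>_. u_star G) \<delta> w y_star"
    and y: "results_from G k N u \<delta> w y"
  define A where "A = (\<Sum>\<tau>=1..N. 1 \<bullet> (p_t y (k + \<tau>) - p_t y_star (k + \<tau>)))"
  define B where "B = (\<Sum>\<tau>=1..N. 1 \<bullet> (p_s y (k + \<tau>) - p_s y_star (k + \<tau>)))"
  have T: "0 < T_s G" using assms(1) by (simp add: valid_parameters_def)
  \<comment> \<open>The final energy surplus is \<open>- T_s G * B\<close>, which turns the energy
    bound into one on \<open>A + B\<close>.\<close>
  have "0 \<le> A" and "- T_s G * B \<le> T_s G * A"
    using u_star_merit_order[OF assms(1,4) w \<delta> y_star y order_refl] by (auto simp: A_def B_def)
  then have "0 \<le> T_s G * (A + B)" by (simp add: algebra_simps)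
  then have "0 \<le> A + B" using T by (simp add: zero_le_mult_iff)
  \<comment> \<open>The on-cost and switching cost depend only on \<delta>, which both operations
    share, and cancel.\<close>
  have "total_cost G k N \<delta> y - total_cost G k N \<delta> y_star = C_t G * A + C_s G * B"
    by (simp add: total_cost_def stage_cost_def A_def B_def sum_distrib_left inner_diff_right
        algebra_simps flip: sum_subtractf sum.distrib)
  also have "\<dots> = C_s G * (A + B) + (C_t G - C_s G) * A"
    by (simp add: algebra_simps)
  also have "\<dots> \<ge> 0"
    using \<open>0 \<le> A\<close> \<open>0 \<le> A + B\<close> assms(2,3) by simp
  finally show "total_cost G k N \<delta> y_star \<le> total_cost G k N \<delta> y" by simp
qed

end
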